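(* Let $\mathsf{JL}$ be any justification logic from the list in the context and $\mathsf{CS}$ a constant specification for $\mathsf{JL}$. The rule $$\frac{\Gamma\Rightarrow\Delta,\varphi\qquad\varphi,\Gamma'\Rightarrow\Delta'}{\Gamma,\Gamma'\Rightarrow\Delta,\Delta'}\ Cut,$$ where $\varphi$ is any formula of one of the forms $w\Vvdash A$, $wRv$, $wE(t,A)$, is $\mathsf{CS}$-admissible in $\mathsf{G3JL}_{\mathsf{CS}}$.
   Context: Justification logics. Terms are built from justification variables and constants by binary $\cdot,+$ and (depending on the logic) unary $!$, $?$, $\bar{?}$. Formulas are built from propositional variables and $\bot$ by $\neg,\wedge,\vee,\to$ and $t:A$. $\mathsf J$ has axiom schemes: propositional tautologies; $s:A\to(s+t):A$, $s:A\to(t+s):A$; $s:(A\to B)\to(t:A\to(s\cdot t):B)$. A justification logic $\mathsf{JL}$ is $\mathsf J$ extended by at most one of (jT) $t:A\to A$, (jD) $t:\bot\to\bot$, and by any subset of (j4) $t:A\to\,!t:t:A$, (jB) $\neg A\to\bar{?}t:\neg t:A$, (j5) $\neg t:A\to\,?t:\neg t:A$; its language contains $!$ (resp. $\bar{?}$, $?$) exactly when (j4) (resp. (jB), (j5)) is an axiom. A constant specification $\mathsf{CS}$ for $\mathsf{JL}$: if (j4) is not an axiom, a set of formulas $c_n:\dots:c_1:A$ ($n\ge1$, $c_j$ constants, $A$ an axiom instance), closed under passing from $c_n:c_{n-1}:\dots:c_1:A$ to $c_{n-1}:\dots:c_1:A$; if (j4) is an axiom, a set of formulas $c:A$ ($c$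 a constant, $A$ an axiom instance). Calculus $\mathsf{G3JL}_{\mathsf{CS}}$. Fix a countably infinite set of labels $w,v,u,\dots$. The labeled language has labeled formulas $w\Vvdash A$, relational atoms $wRv$ and evidence atoms $wE(t,A)$ ($A$ a formula, $t$ a term). Sequents $\Gamma\Rightarrow\Delta$ consist of finite multisets of these. Initial sequents: $w\Vvdash P,\Gamma\Rightarrow\Delta,w\Vvdash P$ ($P$ a propositional variable); $w\Vvdash\bot,\Gamma\Rightarrow\Delta$; $wRv,\Gamma\Rightarrow\Delta,wRv$; $wE(t,A),\Gamma\Rightarrow\Delta,wE(t,A)$. Rules (premises / conclusion): (L$\neg$) $\Gamma\Rightarrow\Delta,w\Vvdash A$ / $w\Vvdash\neg A,\Gamma\Rightarrow\Delta$; (R$\neg$) $w\Vvdash A,\Gamma\Rightarrow\Delta$ / $\Gamma\Rightarrow\Delta,w\Vvdash\neg A$; (L$\wedge$) $w\Vvdash A,w\Vvdash B,\Gamma\Rightarrow\Delta$ / $w\Vvdash A\wedge B,\Gamma\Rightarrow\Delta$; (R$\wedge$) $\Gamma\Rightarrow\Delta,w\Vvdash A$ and $\Gamma\Rightarrow\Delta,w\Vvdash B$ / $\Gamma\Rightarrow\Delta,w\Vvdash A\wedge B$; (L$\vee$) $w\Vvdash A,\Gamma\Rightarrow\Delta$ and $w\Vvdash B,\Gamma\Rightarrow\Delta$ / $w\Vvdash A\vee B,\Gamma\Rightarrow\Delta$; (R$\vee$) $\Gamma\Rightarrow\Delta,w\Vvdash A,w\Vvdash B$ / $\Gamma\Rightarrow\Delta,w\Vvdash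 A\vee B$; (L$\to$) $\Gamma\Rightarrow\Delta,w\Vvdash A$ and $w\Vvdash B,\Gamma\Rightarrow\Delta$ / $w\Vvdash A\to B,\Gamma\Rightarrow\Delta$; (R$\to$) $w\Vvdash A,\Gamma\Rightarrow\Delta,w\Vvdash B$ / $\Gamma\Rightarrow\Delta,w\Vvdash A\to B$; (L:) $v\Vvdash A,w\Vvdash t:A,wRv,\Gamma\Rightarrow\Delta$ / $w\Vvdash t:A,wRv,\Gamma\Rightarrow\Delta$; (R:) $wRv,wE(t,A),\Gamma\Rightarrow\Delta,v\Vvdash A$ / $wE(t,A),\Gamma\Rightarrow\Delta,w\Vvdash t:A$, where the eigenlabel $v$ does not occur in the conclusion; (E) $wE(t,A),w\Vvdash t:A,\Gamma\Rightarrow\Delta$ / $w\Vvdash t:A,\Gamma\Rightarrow\Delta$; (El+) $wE(s+t,A),wE(t,A),\Gamma\Rightarrow\Delta$ / $wE(t,A),\Gamma\Rightarrow\Delta$; (Er+) $wE(t+s,A),wE(t,A),\Gamma\Rightarrow\Delta$ / $wE(t,A),\Gamma\Rightarrow\Delta$; (E$\cdot$) $wE(s\cdot t,B),wE(s,A\to B),wE(t,A),\Gamma\Rightarrow\Delta$ / $wE(s,A\to B),wE(t,A),\Gamma\Rightarrow\Delta$; (IAN)/(AN) $wE(c,F),\Gamma\Rightarrow\Delta$ / $\Gamma\Rightarrow\Delta$, for $c:F\in\mathsf{CS}$ ($c$ a constant). If (jT) is an axiom: (Ref) $wRw,\Gamma\Rightarrow\Delta$ / $\Gamma\Rightarrow\Delta$.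 If (jD) is an axiom: (Ser) $wRv,\Gamma\Rightarrow\Delta$ / $\Gamma\Rightarrow\Delta$, where the eigenlabel $v$ does not occur in the conclusion. If (j4) is an axiom: (E!) $wE(!t,t:A),wE(t,A),\Gamma\Rightarrow\Delta$ / $wE(t,A),\Gamma\Rightarrow\Delta$; (Mon) $vE(t,A),wE(t,A),wRv,\Gamma\Rightarrow\Delta$ / $wE(t,A),wRv,\Gamma\Rightarrow\Delta$; (Trans) $wRu,wRv,vRu,\Gamma\Rightarrow\Delta$ / $wRv,vRu,\Gamma\Rightarrow\Delta$. If (jB) is an axiom: (E$\bar{?}$) $w\Vvdash A,\Gamma\Rightarrow\Delta$ and $wE(\bar{?}t,\neg t:A),\Gamma\Rightarrow\Delta$ / $\Gamma\Rightarrow\Delta$; (Sym) $vRw,wRv,\Gamma\Rightarrow\Delta$ / $wRv,\Gamma\Rightarrow\Delta$. If (j5) is an axiom: (SE) $w\Vvdash t:A,wE(t,A),\Gamma\Rightarrow\Delta$ / $wE(t,A),\Gamma\Rightarrow\Delta$; (E?) $wE(t,A),\Gamma\Rightarrow\Delta$ and $wE(?t,\neg t:A),\Gamma\Rightarrow\Delta$ / $\Gamma\Rightarrow\Delta$. A rule is $\mathsf{CS}$-admissible if whenever an instance of its premise(s) is derivable in $\mathsf{G3JL}_{\mathsf{CS}}$, then so is the corresponding instance of its conclusion. *)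

theory Defs
  imports "HOL-Library.Multiset"
begin

section \<open>Justification logics\<close>

text \<open>
  The type parameters are the propositional variables \<open>'p\<close>, the justification variables \<open>'x\<close>
  and the justification constants \<open>'c\<close>. The datatypes contain all term operations; the
  language of a particular logic is cut out by the predicates \<open>term_lang\<close> and \<open>fm_lang\<close> below.
\<close>

datatype ('x, 'c) jterm =
    JVar 'x
  | JConst 'c
  | App "('x, 'c) jterm" "('x, 'c) jterm"
  | Plus "('x, 'c) jterm" "('x, 'c) jterm"
  | Bang "('x, 'c) jterm"
  | Quest "('x, 'c) jterm"
  | QuestBar "('x, 'c) jterm"

datatype ('p, 'x, 'c) fm =
    PVar 'p
  | Bot
  | Neg "('p, 'x, 'c) fm"
  | Conj "('p, 'x, 'c) fm" "('p, 'x, 'c) fm"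
  | Disj "('p, 'x, 'c) fm" "('p, 'x, 'c) fm"
  | Imp "('p, 'x, 'c) fm" "('p, 'x, 'c) fm"
  | Just "('x, 'c) jterm" "('p, 'x, 'c) fm"

datatype scheme = JT | JD | J4 | JB | J5

text \<open>A logic is identified with the set of schemes by which it extends \<open>J\<close>.\<close>

definition justification_logic :: "scheme set \<Rightarrow> bool" where
  "justification_logic L \<longleftrightarrow> \<not> (JT \<in> L \<and> JD \<in> L)"

primrec term_lang :: "scheme set \<Rightarrow> ('x, 'c) jterm \<Rightarrow> bool" where
  "term_lang L (JVar x) \<longleftrightarrow> True"
| "term_lang L (JConst c) \<longleftrightarrow> True"
| "term_lang L (App s t) \<longleftrightarrow> term_lang L s \<and> term_lang L t"
| "term_lang L (Plus s t) \<longleftrightarrow> term_lang L s \<and> term_lang L t"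
| "term_lang L (Bang t) \<longleftrightarrow> J4 \<in> L \<and> term_lang L t"
| "term_lang L (Quest t) \<longleftrightarrow> J5 \<in> L \<and> term_lang L t"
| "term_lang L (QuestBar t) \<longleftrightarrow> JB \<in> L \<and> term_lang L t"

primrec fm_lang :: "scheme set \<Rightarrow> ('p, 'x, 'c) fm \<Rightarrow> bool" where
  "fm_lang L (PVar P) \<longleftrightarrow> True"
| "fm_lang L Bot \<longleftrightarrow> True"
| "fm_lang L (Neg A) \<longleftrightarrow> fm_lang L A"
| "fm_lang L (Conj A B) \<longleftrightarrow> fm_lang L A \<and> fm_lang L B"
| "fm_lang L (Disj A B) \<longleftrightarrow> fm_lang L A \<and> fm_lang L B"
| "fm_lang L (Imp A B) \<longleftrightarrow> fm_lang L A \<and> fm_lang L B"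
| "fm_lang L (Just t A) \<longleftrightarrow> term_lang L t \<and> fm_lang L A"

text \<open>
  Propositional tautologies: formulas \<open>t:A\<close> count as atoms, with truth values independent of
  those of \<open>A\<close>.
\<close>

primrec prop_eval ::
  "('p \<Rightarrow> bool) \<Rightarrow> (('x, 'c) jterm \<Rightarrow> ('p, 'x, 'c) fm \<Rightarrow> bool) \<Rightarrow> ('p, 'x, 'c) fm \<Rightarrow> bool" where
  "prop_eval V J (PVar P) \<longleftrightarrow> V P"
| "prop_eval V J Bot \<longleftrightarrow> False"
| "prop_eval V J (Neg A) \<longleftrightarrow> \<not> prop_eval V J A"
| "prop_eval V J (Conj A B) \<longleftrightarrow> prop_eval V J A \<and> prop_eval V J B"
| "prop_eval V J (Disj A B) \<longleftrightarrow> prop_eval V J A \<or> prop_eval V J B"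
| "prop_eval V J (Imp A B) \<longleftrightarrow> (prop_eval V J A \<longrightarrow> prop_eval V J B)"
| "prop_eval V J (Just t A) \<longleftrightarrow> J t A"

definition tautology :: "('p, 'x, 'c) fm \<Rightarrow> bool" where
  "tautology A \<longleftrightarrow> (\<forall>V J. prop_eval V J A)"

inductive scheme_inst :: "scheme set \<Rightarrow> ('p, 'x, 'c) fm \<Rightarrow> bool" for L where
  taut: "tautology A \<Longrightarrow> scheme_inst L A"
| sum_left: "scheme_inst L (Imp (Just s A) (Just (Plus s t) A))"
| sum_right: "scheme_inst L (Imp (Just s A) (Just (Plus t s) A))"
| app: "scheme_inst L (Imp (Just s (Imp A B)) (Imp (Just t A) (Just (App s t) B)))"
| jT: "JT \<in> L \<Longrightarrow> scheme_inst L (Imp (Just t A) A)"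
| jD: "JD \<in> L \<Longrightarrow> scheme_inst L (Imp (Just t Bot) Bot)"
| j4: "J4 \<in> L \<Longrightarrow> scheme_inst L (Imp (Just t A) (Just (Bang t) (Just t A)))"
| jB: "JB \<in> L \<Longrightarrow> scheme_inst L (Imp (Neg A) (Just (QuestBar t) (Neg (Just t A))))"
| j5: "J5 \<in> L \<Longrightarrow> scheme_inst L (Imp (Neg (Just t A)) (Just (Quest t) (Neg (Just t A))))"

definition axiom_inst :: "scheme set \<Rightarrow> ('p, 'x, 'c) fm \<Rightarrow> bool" where
  "axiom_inst L A \<longleftrightarrow> fm_lang L A \<and> scheme_inst L A"

text \<open>\<open>const_prefix [c\<^sub>n, \<dots>, c\<^sub>1] A\<close> is \<open>c\<^sub>n : \<dots> : c\<^sub>1 : A\<close>.\<close>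

definition const_prefix :: "'c list \<Rightarrow> ('p, 'x, 'c) fm \<Rightarrow> ('p, 'x, 'c) fm" where
  "const_prefix cs A = foldr (\<lambda>c F. Just (JConst c) F) cs A"

definition constant_specification :: "scheme set \<Rightarrow> ('p, 'x, 'c) fm set \<Rightarrow> bool" where
  "constant_specification L CS \<longleftrightarrow>
     (if J4 \<in> L
      then \<forall>F\<in>CS. \<exists>c A. F = Just (JConst c) A \<and> axiom_inst L A
      else (\<forall>F\<in>CS. \<exists>cs A. cs \<noteq> [] \<and> F = const_prefix cs A \<and> axiom_inst L A) \<and>
           (\<forall>c cs A. cs \<noteq> [] \<and> axiom_inst L A \<and> const_prefix (c # cs) A \<in> CS
              \<longrightarrow> const_prefix cs A \<in> CS))"


section \<open>The labeled sequent calculus\<close>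

type_synonym label = nat

text \<open>\<open>Forces w A\<close>, \<open>Rel w v\<close> and \<open>Ev w t A\<close> are \<open>w \<tturnstile> A\<close>, \<open>w R v\<close> and \<open>w E (t, A)\<close>.\<close>

datatype ('p, 'x, 'c) lfm =
    Forces label "('p, 'x, 'c) fm"
  | Rel label label
  | Ev label "('x, 'c) jterm" "('p, 'x, 'c) fm"

primrec lfm_lang :: "scheme set \<Rightarrow> ('p, 'x, 'c) lfm \<Rightarrow> bool" where
  "lfm_lang L (Forces w A) \<longleftrightarrow> fm_lang L A"
| "lfm_lang L (Rel w v) \<longleftrightarrow> True"
| "lfm_lang L (Ev w t A) \<longleftrightarrow> term_lang L t \<and> fm_lang L A"

primrec lfm_labels :: "('p, 'x, 'c) lfm \<Rightarrow> label set" where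
  "lfm_labels (Forces w A) = {w}"
| "lfm_labels (Rel w v) = {w, v}"
| "lfm_labels (Ev w t A) = {w}"

datatype ('p, 'x, 'c) sequent =
  Sequent "('p, 'x, 'c) lfm multiset" "('p, 'x, 'c) lfm multiset"  (infix \<open>\<Rrightarrow>\<close> 50)

primrec seq_lang :: "scheme set \<Rightarrow> ('p, 'x, 'c) sequent \<Rightarrow> bool" where
  "seq_lang L (\<Gamma> \<Rrightarrow> \<Delta>) \<longleftrightarrow> (\<forall>\<phi> \<in> set_mset (\<Gamma> + \<Delta>). lfm_lang L \<phi>)"

primrec seq_labels :: "('p, 'x, 'c) sequent \<Rightarrow> label set" where
  "seq_labels (\<Gamma> \<Rrightarrow> \<Delta>) = (\<Union>\<phi> \<in> set_mset (\<Gamma> + \<Delta>). lfm_labels \<phi>)"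

text \<open>
  A rule is the relation between the list of premises and the conclusion of its instances.
  Initial sequents are instances without premises.
\<close>

type_synonym ('p, 'x, 'c) rule = "('p, 'x, 'c) sequent list \<Rightarrow> ('p, 'x, 'c) sequent \<Rightarrow> bool"

inductive G3JL_rule :: "scheme set \<Rightarrow> ('p, 'x, 'c) fm set \<Rightarrow> ('p, 'x, 'c) rule"
  for L CS where
  InitP: "G3JL_rule L CS [] (add_mset (Forces w (PVar P)) \<Gamma> \<Rrightarrow> add_mset (Forces w (PVar P)) \<Delta>)"
| InitBot: "G3JL_rule L CS [] (add_mset (Forces w Bot) \<Gamma> \<Rrightarrow> \<Delta>)"
| InitR: "G3JL_rule L CS [] (add_mset (Rel w v) \<Gamma> \<Rrightarrow> add_mset (Rel w v) \<Delta>)"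
| InitE: "G3JL_rule L CS [] (add_mset (Ev w t A) \<Gamma> \<Rrightarrow> add_mset (Ev w t A) \<Delta>)"
| LNeg: "G3JL_rule L CS
    [\<Gamma> \<Rrightarrow> add_mset (Forces w A) \<Delta>]
    (add_mset (Forces w (Neg A)) \<Gamma> \<Rrightarrow> \<Delta>)"
| RNeg: "G3JL_rule L CS
    [add_mset (Forces w A) \<Gamma> \<Rrightarrow> \<Delta>]
    (\<Gamma> \<Rrightarrow> add_mset (Forces w (Neg A)) \<Delta>)"
| LConj: "G3JL_rule L CS
    [add_mset (Forces w A) (add_mset (Forces w B) \<Gamma>) \<Rrightarrow> \<Delta>]
    (add_mset (Forces w (Conj A B)) \<Gamma> \<Rrightarrow> \<Delta>)"
| RConj: "G3JL_rule L CS
    [\<Gamma> \<Rrightarrow> add_mset (Forces w A) \<Delta>,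
     \<Gamma> \<Rrightarrow> add_mset (Forces w B) \<Delta>]
    (\<Gamma> \<Rrightarrow> add_mset (Forces w (Conj A B)) \<Delta>)"
| LDisj: "G3JL_rule L CS
    [add_mset (Forces w A) \<Gamma> \<Rrightarrow> \<Delta>,
     add_mset (Forces w B) \<Gamma> \<Rrightarrow> \<Delta>]
    (add_mset (Forces w (Disj A B)) \<Gamma> \<Rrightarrow> \<Delta>)"
| RDisj: "G3JL_rule L CS
    [\<Gamma> \<Rrightarrow> add_mset (Forces w A) (add_mset (Forces w B) \<Delta>)]
    (\<Gamma> \<Rrightarrow> add_mset (Forces w (Disj A B)) \<Delta>)"
| LImp: "G3JL_rule L CS
    [\<Gamma> \<Rrightarrow> add_mset (Forces w A) \<Delta>,
     add_mset (Forces w B) \<Gamma> \<Rrightarrow> \<Delta>]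
    (add_mset (Forces w (Imp A B)) \<Gamma> \<Rrightarrow> \<Delta>)"
| RImp: "G3JL_rule L CS
    [add_mset (Forces w A) \<Gamma> \<Rrightarrow> add_mset (Forces w B) \<Delta>]
    (\<Gamma> \<Rrightarrow> add_mset (Forces w (Imp A B)) \<Delta>)"
| LJust: "G3JL_rule L CS
    [add_mset (Forces v A) (add_mset (Forces w (Just t A)) (add_mset (Rel w v) \<Gamma>)) \<Rrightarrow> \<Delta>]
    (add_mset (Forces w (Just t A)) (add_mset (Rel w v) \<Gamma>) \<Rrightarrow> \<Delta>)"
| RJust: "v \<notin> seq_labels (add_mset (Ev w t A) \<Gamma> \<Rrightarrow> add_mset (Forces w (Just t A)) \<Delta>) \<Longrightarrow>
   G3JL_rule L CS
    [add_mset (Rel w v) (add_mset (Ev w t A) \<Gamma>) \<Rrightarrow> add_mset (Forces v A) \<Delta>]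
    (add_mset (Ev w t A) \<Gamma> \<Rrightarrow> add_mset (Forces w (Just t A)) \<Delta>)"
| E: "G3JL_rule L CS
    [add_mset (Ev w t A) (add_mset (Forces w (Just t A)) \<Gamma>) \<Rrightarrow> \<Delta>]
    (add_mset (Forces w (Just t A)) \<Gamma> \<Rrightarrow> \<Delta>)"
| EPlusL: "G3JL_rule L CS
    [add_mset (Ev w (Plus s t) A) (add_mset (Ev w t A) \<Gamma>) \<Rrightarrow> \<Delta>]
    (add_mset (Ev w t A) \<Gamma> \<Rrightarrow> \<Delta>)"
| EPlusR: "G3JL_rule L CS
    [add_mset (Ev w (Plus t s) A) (add_mset (Ev w t A) \<Gamma>) \<Rrightarrow> \<Delta>]
    (add_mset (Ev w t A) \<Gamma> \<Rrightarrow> \<Delta>)"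
| EApp: "G3JL_rule L CS
    [add_mset (Ev w (App s t) B) (add_mset (Ev w s (Imp A B)) (add_mset (Ev w t A) \<Gamma>)) \<Rrightarrow> \<Delta>]
    (add_mset (Ev w s (Imp A B)) (add_mset (Ev w t A) \<Gamma>) \<Rrightarrow> \<Delta>)"
| AN: "Just (JConst c) F \<in> CS \<Longrightarrow>
   G3JL_rule L CS
    [add_mset (Ev w (JConst c) F) \<Gamma> \<Rrightarrow> \<Delta>]
    (\<Gamma> \<Rrightarrow> \<Delta>)"
| Ref: "JT \<in> L \<Longrightarrow>
   G3JL_rule L CS
    [add_mset (Rel w w) \<Gamma> \<Rrightarrow> \<Delta>]
    (\<Gamma> \<Rrightarrow> \<Delta>)"
| Ser: "JD \<in> L \<Longrightarrow> v \<notin> seq_labels (\<Gamma> \<Rrightarrow> \<Delta>) \<Longrightarrow>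
   G3JL_rule L CS
    [add_mset (Rel w v) \<Gamma> \<Rrightarrow> \<Delta>]
    (\<Gamma> \<Rrightarrow> \<Delta>)"
| EBang: "J4 \<in> L \<Longrightarrow>
   G3JL_rule L CS
    [add_mset (Ev w (Bang t) (Just t A)) (add_mset (Ev w t A) \<Gamma>) \<Rrightarrow> \<Delta>]
    (add_mset (Ev w t A) \<Gamma> \<Rrightarrow> \<Delta>)"
| Mon: "J4 \<in> L \<Longrightarrow>
   G3JL_rule L CS
    [add_mset (Ev v t A) (add_mset (Ev w t A) (add_mset (Rel w v) \<Gamma>)) \<Rrightarrow> \<Delta>]
    (add_mset (Ev w t A) (add_mset (Rel w v) \<Gamma>) \<Rrightarrow> \<Delta>)"
| Trans: "J4 \<in> L \<Longrightarrow>
   G3JL_rule L CS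
    [add_mset (Rel w u) (add_mset (Rel w v) (add_mset (Rel v u) \<Gamma>)) \<Rrightarrow> \<Delta>]
    (add_mset (Rel w v) (add_mset (Rel v u) \<Gamma>) \<Rrightarrow> \<Delta>)"
| EQuestBar: "JB \<in> L \<Longrightarrow>
   G3JL_rule L CS
    [add_mset (Forces w A) \<Gamma> \<Rrightarrow> \<Delta>,
     add_mset (Ev w (QuestBar t) (Neg (Just t A))) \<Gamma> \<Rrightarrow> \<Delta>]
    (\<Gamma> \<Rrightarrow> \<Delta>)"
| Sym: "JB \<in> L \<Longrightarrow>
   G3JL_rule L CS
    [add_mset (Rel v w) (add_mset (Rel w v) \<Gamma>) \<Rrightarrow> \<Delta>]
    (add_mset (Rel w v) \<Gamma> \<Rrightarrow> \<Delta>)"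
| SE: "J5 \<in> L \<Longrightarrow>
   G3JL_rule L CS
    [add_mset (Forces w (Just t A)) (add_mset (Ev w t A) \<Gamma>) \<Rrightarrow> \<Delta>]
    (add_mset (Ev w t A) \<Gamma> \<Rrightarrow> \<Delta>)"
| EQuest: "J5 \<in> L \<Longrightarrow>
   G3JL_rule L CS
    [add_mset (Ev w t A) \<Gamma> \<Rrightarrow> \<Delta>,
     add_mset (Ev w (Quest t) (Neg (Just t A))) \<Gamma> \<Rrightarrow> \<Delta>]
    (\<Gamma> \<Rrightarrow> \<Delta>)"

text \<open>
  Every sequent in a derivation belongs to the labeled language of the logic: conclusions are
  required to by \<open>seq_lang\<close>, and premises are themselves conclusions of derivations.
\<close>

inductive derivable :: "scheme set \<Rightarrow> ('p, 'x, 'c) fm set \<Rightarrow> ('p, 'x, 'c) sequent \<Rightarrow> bool"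
  for L CS where
  "G3JL_rule L CS Ps S \<Longrightarrow> seq_lang L S \<Longrightarrow> \<forall>P\<in>set Ps. derivable L CS P \<Longrightarrow> derivable L CS S"

definition admissible :: "scheme set \<Rightarrow> ('p, 'x, 'c) fm set \<Rightarrow> ('p, 'x, 'c) rule \<Rightarrow> bool" where
  "admissible L CS r \<longleftrightarrow>
     (\<forall>Ps S. r Ps S \<longrightarrow> (\<forall>P\<in>set Ps. derivable L CS P) \<longrightarrow> derivable L CS S)"

inductive Cut :: "('p, 'x, 'c) rule" where
  "Cut [\<Gamma> \<Rrightarrow> add_mset \<phi> \<Delta>, add_mset \<phi> \<Gamma>' \<Rrightarrow> \<Delta>'] (\<Gamma> + \<Gamma>' \<Rrightarrow> \<Delta> + \<Delta>')"

end

theory Submission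
  imports Defs
begin

text \<open>
  The usual cut elimination argument for G3 calculi needs height-preserving weakening, inversion
  and contraction, each of them again disturbed by the eigenlabel conditions. The proof below
  moves to an auxiliary calculus in which these properties are built in, proves cut there, and
  moves back.

  The auxiliary calculus (\<open>provable\<close>) works on sets of signed labelled formulas, and its premises
  contain the conclusion, so that contraction is invisible and weakening is immediate. A rule with an
  eigenlabel has one premise for each label (or for all but finitely many labels) instead of a
  single premise with a fresh label, so that no freshness condition restricts the context.

  Cut in the auxiliary calculus rests on \<open>provable_eliminate\<close>: a signed formula can be dropped from
  a provable set as soon as every rule application that uses it can be bypassed in every larger
  set. Applying this to the right cut formula, and inside each application that uses it to the left
  one, leaves only the pairs of rules in which both copies are principal; these are reduced to the
  subformulas, by induction on the cut formula. A propositional variable, relational atom or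
  evidence atom on the right is principal only in initial sequents, where it also occurs on the
  left. The formula \<open>t : A\<close> is principal on the left in two rules: against (L:) the premise of (R:) at the label of the
  relational atom in use provides a cut on \<open>A\<close>, and against (E) the evidence atom that (R:) demands
  is already there.

  From the original calculus to the auxiliary one (\<open>derivable_provable\<close>), the derivation is
  translated under all relabellings at once; changing the relabelling at the eigenlabel gives all
  premises of the auxiliary rule. Back again (\<open>provable_derivable\<close>), a provable set is realised not
  only by sequents that contain it, but by all sequents that cover it: a formula may be replaced by
  the formulas that one premise of its own rule adds. This absorbs inversion and contraction
  into the induction hypothesis, and an eigenlabel can be picked fresh for the finite sequent.
\<close>

section \<open>A cumulative calculus on sets\<close>

datatype ('p, 'x, 'c) sfm = Lhs "('p, 'x, 'c) lfm" | Rhs "('p, 'x, 'c) lfm"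

primrec sfm_lang :: "scheme set \<Rightarrow> ('p, 'x, 'c) sfm \<Rightarrow> bool" where
  "sfm_lang L (Lhs \<phi>) = lfm_lang L \<phi>"
| "sfm_lang L (Rhs \<phi>) = lfm_lang L \<phi>"

text \<open>
  In \<open>schema L CS P D I\<close> the conclusion of the original rule has principal formulas \<open>P \<union> D\<close>, of which
  those in \<open>P\<close> are repeated in the premises and those in \<open>D\<close> are not; each \<open>Q \<in> I\<close> is what one premise
  adds.

  Seriality gives two schemas. The rule (Ser) asks that \<open>v\<close> be absent from the conclusion but not
  that \<open>w \<noteq> v\<close>, so it may also introduce a single fresh reflexive label. That instance does not hold
  for all labels, because a loop at a label already in use need not be available; \<open>SerLoop\<close>
  therefore excludes a finite set of labels. The set is a parameter of the schema, not the label
  set of the context, since otherwise weakening would fail.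
\<close>
inductive schema :: "scheme set \<Rightarrow> ('p, 'x, 'c) fm set \<Rightarrow>
    ('p, 'x, 'c) sfm set \<Rightarrow> ('p, 'x, 'c) sfm set \<Rightarrow> ('p, 'x, 'c) sfm set set \<Rightarrow> bool"
  for L CS where
  InitP: "schema L CS {Lhs (Forces w (PVar P)), Rhs (Forces w (PVar P))} {} {}"
| InitBot: "schema L CS {Lhs (Forces w Bot)} {} {}"
| InitR: "schema L CS {Lhs (Rel w v), Rhs (Rel w v)} {} {}"
| InitE: "schema L CS {Lhs (Ev w t A), Rhs (Ev w t A)} {} {}"
| LNeg: "schema L CS {} {Lhs (Forces w (Neg A))} {{Rhs (Forces w A)}}"
| RNeg: "schema L CS {} {Rhs (Forces w (Neg A))} {{Lhs (Forces w A)}}"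
| LConj: "schema L CS {} {Lhs (Forces w (Conj A B))} {{Lhs (Forces w A), Lhs (Forces w B)}}"
| RConj: "schema L CS {} {Rhs (Forces w (Conj A B))} {{Rhs (Forces w A)}, {Rhs (Forces w B)}}"
| LDisj: "schema L CS {} {Lhs (Forces w (Disj A B))} {{Lhs (Forces w A)}, {Lhs (Forces w B)}}"
| RDisj: "schema L CS {} {Rhs (Forces w (Disj A B))} {{Rhs (Forces w A), Rhs (Forces w B)}}"
| LImp: "schema L CS {} {Lhs (Forces w (Imp A B))} {{Rhs (Forces w A)}, {Lhs (Forces w B)}}"
| RImp: "schema L CS {} {Rhs (Forces w (Imp A B))} {{Lhs (Forces w A), Rhs (Forces w B)}}"
| LJust: "schema L CS {Lhs (Forces w (Just t A)), Lhs (Rel w v)} {} {{Lhs (Forces v A)}}"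
| RJust: "schema L CS {Lhs (Ev w t A)} {Rhs (Forces w (Just t A))}
    (range (\<lambda>v. {Lhs (Rel w v), Rhs (Forces v A)}))"
| E: "schema L CS {Lhs (Forces w (Just t A))} {} {{Lhs (Ev w t A)}}"
| EPlusL: "schema L CS {Lhs (Ev w t A)} {} {{Lhs (Ev w (Plus s t) A)}}"
| EPlusR: "schema L CS {Lhs (Ev w t A)} {} {{Lhs (Ev w (Plus t s) A)}}"
| EApp: "schema L CS {Lhs (Ev w s (Imp A B)), Lhs (Ev w t A)} {} {{Lhs (Ev w (App s t) B)}}"
| AN: "Just (JConst c) F \<in> CS \<Longrightarrow> schema L CS {} {} {{Lhs (Ev w (JConst c) F)}}"
| Ref: "JT \<in> L \<Longrightarrow> schema L CS {} {} {{Lhs (Rel w w)}}"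
| Ser: "JD \<in> L \<Longrightarrow> schema L CS {} {} (range (\<lambda>v. {Lhs (Rel w v)}))"
| SerLoop: "JD \<in> L \<Longrightarrow> finite F \<Longrightarrow> schema L CS {} {} ((\<lambda>v. {Lhs (Rel v v)}) ` (- F))"
| EBang: "J4 \<in> L \<Longrightarrow> schema L CS {Lhs (Ev w t A)} {} {{Lhs (Ev w (Bang t) (Just t A))}}"
| Mon: "J4 \<in> L \<Longrightarrow> schema L CS {Lhs (Ev w t A), Lhs (Rel w v)} {} {{Lhs (Ev v t A)}}"
| Trans: "J4 \<in> L \<Longrightarrow> schema L CS {Lhs (Rel w v), Lhs (Rel v u)} {} {{Lhs (Rel w u)}}"
| EQuestBar: "JB \<in> L \<Longrightarrow>
    schema L CS {} {} {{Lhs (Forces w A)}, {Lhs (Ev w (QuestBar t) (Neg (Just t A)))}}"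
| Sym: "JB \<in> L \<Longrightarrow> schema L CS {Lhs (Rel w v)} {} {{Lhs (Rel v w)}}"
| SE: "J5 \<in> L \<Longrightarrow> schema L CS {Lhs (Ev w t A)} {} {{Lhs (Forces w (Just t A))}}"
| EQuest: "J5 \<in> L \<Longrightarrow>
    schema L CS {} {} {{Lhs (Ev w t A)}, {Lhs (Ev w (Quest t) (Neg (Just t A)))}}"

text \<open>
  The premises of the only rule that consumes a given signed formula; empty for formulas that every
  rule repeats in its premises.
\<close>
fun reducts :: "('p, 'x, 'c) sfm \<Rightarrow> ('p, 'x, 'c) sfm set set" where
  "reducts (Lhs (Forces w (Neg A))) = {{Rhs (Forces w A)}}"
| "reducts (Rhs (Forces w (Neg A))) = {{Lhs (Forces w A)}}"
| "reducts (Lhs (Forces w (Conj A B))) = {{Lhs (Forces w A), Lhs (Forces w B)}}"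
| "reducts (Rhs (Forces w (Conj A B))) = {{Rhs (Forces w A)}, {Rhs (Forces w B)}}"
| "reducts (Lhs (Forces w (Disj A B))) = {{Lhs (Forces w A)}, {Lhs (Forces w B)}}"
| "reducts (Rhs (Forces w (Disj A B))) = {{Rhs (Forces w A), Rhs (Forces w B)}}"
| "reducts (Lhs (Forces w (Imp A B))) = {{Rhs (Forces w A)}, {Lhs (Forces w B)}}"
| "reducts (Rhs (Forces w (Imp A B))) = {{Lhs (Forces w A), Rhs (Forces w B)}}"
| "reducts (Rhs (Forces w (Just t A))) = range (\<lambda>v. {Lhs (Rel w v), Rhs (Forces v A)})"
| "reducts _ = {}"

lemma schema_kept: "schema L CS P D I \<Longrightarrow> \<chi> \<in> P \<Longrightarrow> reducts \<chi> = {}"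
  by (erule schema.cases) auto

lemma schema_consumed:
  assumes "schema L CS P D I" "\<chi> \<in> D"
  shows "I = reducts \<chi>"
  using assms by (auto elim!: schema.cases)

lemma schema_reducts:
  assumes "schema L CS P D I" "\<chi> \<in> P \<union> D" "reducts \<chi> \<noteq> {}"
  shows "I = reducts \<chi>"
  using assms schema_kept schema_consumed by blast

text \<open>
  Only the added formulas have to belong to the language. A condition on \<open>S\<close> itself would have to be
  carried through weakening and cut, while this one suffices: if the end sequent is in the language, then so is every sequent
  above it.
\<close>
inductive provable :: "scheme set \<Rightarrow> ('p, 'x, 'c) fm set \<Rightarrow> ('p, 'x, 'c) sfm set \<Rightarrow> bool"
  for L CS where
  step: "schema L CS P D I \<Longrightarrow> P \<union> D \<subseteq> S \<Longrightarrow> \<forall>\<chi>\<in>\<Union>I. sfm_lang L \<chi> \<Longrightarrow>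
    (\<And>Q. Q \<in> I \<Longrightarrow> provable L CS (Q \<union> S)) \<Longrightarrow> provable L CS S"

lemma provable_weaken:
  assumes "provable L CS S" "S \<subseteq> T"
  shows "provable L CS T"
  using assms
proof (induction arbitrary: T rule: provable.induct)
  case (step P D I S)
  show ?case
    by (rule provable.step[OF step.hyps(1)]) (use step in blast)+
qed

section \<open>Cut in the cumulative calculus\<close>

text \<open>
  The derivation is rebuilt without \<open>\<chi>\<close>. Rules that do not use \<open>\<chi>\<close> are repeated; at a rule that
  uses it, the premises have already been rebuilt and the last assumption yields the conclusion.
  Since contexts only grow towards the leaves, that assumption is needed for all \<open>T \<supseteq> S\<close>. The
  inclusion for \<open>N\<close> incorporates weakening, for use inside another elimination, where the context
  has already grown.
\<close>
lemma provable_eliminate: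
  assumes "provable L CS N" "N \<subseteq> insert \<chi> S"
    and "\<And>P D I T. S \<subseteq> T \<Longrightarrow> schema L CS P D I \<Longrightarrow> \<chi> \<in> P \<union> D \<Longrightarrow> P \<union> D \<subseteq> insert \<chi> T \<Longrightarrow>
      (\<And>Q. Q \<in> I \<Longrightarrow> provable L CS (Q \<union> T)) \<Longrightarrow> provable L CS T"
  shows "provable L CS S"
  using assms
proof (induction arbitrary: S rule: provable.induct)
  case (step P D I N)
  have sub: "P \<union> D \<subseteq> insert \<chi> S"
    using step.hyps(2) step.prems(1) by blast
  have prem: "provable L CS (Q \<union> S)" if "Q \<in> I" for Q
  proof (rule step.IH[OF that])
    show "Q \<union> N \<subseteq> insert \<chi> (Q \<union> S)"
      using step.prems(1) by blast
  next
    fix P D I T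
    assume "Q \<union> S \<subseteq> T" "schema L CS P D I" "\<chi> \<in> P \<union> D" "P \<union> D \<subseteq> insert \<chi> T"
      "\<And>Q. Q \<in> I \<Longrightarrow> provable L CS (Q \<union> T)"
    then show "provable L CS T"
      using step.prems(2)[of T P D I] by blast
  qed
  show ?case
  proof (cases "\<chi> \<in> P \<union> D")
    case True
    show ?thesis
      by (rule step.prems(2)[OF subset_refl step.hyps(1) True sub prem])
  next
    case False
    with sub have "P \<union> D \<subseteq> S"
      by blast
    then show ?thesis
      by (rule provable.step[OF step.hyps(1) _ step.hyps(3) prem])
  qed
qed

text \<open>Two nested eliminations reduce a cut to the case where both copies are principal.\<close>
lemma principal_cut:
  assumes "provable L CS (insert (Lhs \<phi>) S)" "provable L CS (insert (Rhs \<phi>) S)"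
    and "\<And>P D I P' D' I' T. S \<subseteq> T \<Longrightarrow>
      schema L CS P D I \<Longrightarrow> Lhs \<phi> \<in> P \<union> D \<Longrightarrow> P \<union> D \<subseteq> insert (Lhs \<phi>) T \<Longrightarrow>
      schema L CS P' D' I' \<Longrightarrow> Rhs \<phi> \<in> P' \<union> D' \<Longrightarrow> P' \<union> D' \<subseteq> insert (Rhs \<phi>) T \<Longrightarrow>
      \<forall>Q\<in>I. provable L CS (Q \<union> T) \<Longrightarrow> \<forall>Q\<in>I'. provable L CS (Q \<union> T) \<Longrightarrow> provable L CS T"
  shows "provable L CS S"
proof (rule provable_eliminate[OF assms(2) subset_refl])
  fix P' D' I' T
  assume T: "S \<subseteq> T" and r: "schema L CS P' D' I'" "Rhs \<phi> \<in> P' \<union> D'" "P' \<union> D' \<subseteq> insert (Rhs \<phi>) T"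
    and pr: "\<And>Q. Q \<in> I' \<Longrightarrow> provable L CS (Q \<union> T)"
  show "provable L CS T"
  proof (rule provable_eliminate[OF assms(1)])
    show "insert (Lhs \<phi>) S \<subseteq> insert (Lhs \<phi>) T"
      using T by blast
  next
    fix P D I T'
    assume T': "T \<subseteq> T'" and l: "schema L CS P D I" "Lhs \<phi> \<in> P \<union> D" "P \<union> D \<subseteq> insert (Lhs \<phi>) T'"
      and pl: "\<And>Q. Q \<in> I \<Longrightarrow> provable L CS (Q \<union> T')"
    show "provable L CS T'"
    proof (rule assms(3)[OF _ l r(1,2)])
      show "S \<subseteq> T'" "P' \<union> D' \<subseteq> insert (Rhs \<phi>) T'"
        using T T' r(3) by blast+
      show "\<forall>Q\<in>I. provable L CS (Q \<union> T')"
        using pl by blast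
      show "\<forall>Q\<in>I'. provable L CS (Q \<union> T')"
        using T' by (blast intro: provable_weaken[OF pr])
    qed
  qed
qed

text \<open>
  Where the right copy is used, the left copy must be present in the context, so that the left
  premise of the cut is itself provable from the context.
\<close>
lemma cut_atom:
  assumes "provable L CS (insert (Lhs \<phi>) S)" "provable L CS (insert (Rhs \<phi>) S)"
    and "\<And>P D I. schema L CS P D I \<Longrightarrow> Rhs \<phi> \<in> P \<union> D \<Longrightarrow> Lhs \<phi> \<in> P \<union> D"
  shows "provable L CS S"
proof (rule provable_eliminate[OF assms(2) subset_refl])
  fix P D I T
  assume T: "S \<subseteq> T" and r: "schema L CS P D I" "Rhs \<phi> \<in> P \<union> D" "P \<union> D \<subseteq> insert (Rhs \<phi>) T"
  have "Lhs \<phi> \<in> T"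
    using assms(3)[OF r(1,2)] r(3) by auto
  with T show "provable L CS T"
    by (blast intro: provable_weaken[OF assms(1)])
qed

lemma cut_forces:
  assumes "provable L CS (insert (Lhs (Forces w A)) S)" "provable L CS (insert (Rhs (Forces w A)) S)"
  shows "provable L CS S"
  using assms
proof (induction A arbitrary: w S)
  case (PVar x)
  show ?case
    by (rule cut_atom[OF PVar]) (erule schema.cases; auto)
next
  case Bot
  show ?case
    by (rule cut_atom[OF Bot]) (erule schema.cases; auto)
next
  case (Neg A)
  show ?case
  proof (rule principal_cut[OF Neg.prems])
    fix P D I P' D' I' T
    assume *: "schema L CS P D I" "Lhs (Forces w (Neg A)) \<in> P \<union> D"
      "schema L CS P' D' I'" "Rhs (Forces w (Neg A)) \<in> P' \<union> D'"
      "\<forall>Q\<in>I. provable L CS (Q \<union> T)" "\<forall>Q\<in>I'. provable L CS (Q \<union> T)"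
    have I: "I = {{Rhs (Forces w A)}}" "I' = {{Lhs (Forces w A)}}"
      using schema_reducts[OF *(1,2)] schema_reducts[OF *(3,4)] by simp_all
    show "provable L CS T"
      by (rule Neg.IH[of w]) (use *(5,6) I in simp_all)
  qed
next
  case (Conj A B)
  show ?case
  proof (rule principal_cut[OF Conj.prems])
    fix P D I P' D' I' T
    assume *: "schema L CS P D I" "Lhs (Forces w (Conj A B)) \<in> P \<union> D"
      "schema L CS P' D' I'" "Rhs (Forces w (Conj A B)) \<in> P' \<union> D'"
      "\<forall>Q\<in>I. provable L CS (Q \<union> T)" "\<forall>Q\<in>I'. provable L CS (Q \<union> T)"
    have I: "I = {{Lhs (Forces w A), Lhs (Forces w B)}}"
      "I' = {{Rhs (Forces w A)}, {Rhs (Forces w B)}}"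
      using schema_reducts[OF *(1,2)] schema_reducts[OF *(3,4)] by simp_all
    have prem: "provable L CS (insert (Lhs (Forces w A)) (insert (Lhs (Forces w B)) T))"
      "provable L CS (insert (Rhs (Forces w A)) T)" "provable L CS (insert (Rhs (Forces w B)) T)"
      using *(5,6) I by simp_all
    have weak: "provable L CS (insert (Rhs (Forces w A)) (insert (Lhs (Forces w B)) T))"
      using prem(2) by (rule provable_weaken) blast
    have cutA: "provable L CS (insert (Lhs (Forces w B)) T)"
      by (rule Conj.IH(1)[OF prem(1) weak])
    show "provable L CS T"
      by (rule Conj.IH(2)[OF cutA prem(3)])
  qed
next
  case (Disj A B)
  show ?case
  proof (rule principal_cut[OF Disj.prems])
    fix P D I P' D' I' T
    assume *: "schema L CS P D I" "Lhs (Forces w (Disj A B)) \<in> P \<union> D"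
      "schema L CS P' D' I'" "Rhs (Forces w (Disj A B)) \<in> P' \<union> D'"
      "\<forall>Q\<in>I. provable L CS (Q \<union> T)" "\<forall>Q\<in>I'. provable L CS (Q \<union> T)"
    have I: "I = {{Lhs (Forces w A)}, {Lhs (Forces w B)}}"
      "I' = {{Rhs (Forces w A), Rhs (Forces w B)}}"
      using schema_reducts[OF *(1,2)] schema_reducts[OF *(3,4)] by simp_all
    have prem: "provable L CS (insert (Rhs (Forces w A)) (insert (Rhs (Forces w B)) T))"
      "provable L CS (insert (Lhs (Forces w A)) T)" "provable L CS (insert (Lhs (Forces w B)) T)"
      using *(5,6) I by simp_all
    have weak: "provable L CS (insert (Lhs (Forces w A)) (insert (Rhs (Forces w B)) T))"
      using prem(2) by (rule provable_weaken) blast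
    have cutA: "provable L CS (insert (Rhs (Forces w B)) T)"
      by (rule Disj.IH(1)[OF weak prem(1)])
    show "provable L CS T"
      by (rule Disj.IH(2)[OF prem(3) cutA])
  qed
next
  case (Imp A B)
  show ?case
  proof (rule principal_cut[OF Imp.prems])
    fix P D I P' D' I' T
    assume *: "schema L CS P D I" "Lhs (Forces w (Imp A B)) \<in> P \<union> D"
      "schema L CS P' D' I'" "Rhs (Forces w (Imp A B)) \<in> P' \<union> D'"
      "\<forall>Q\<in>I. provable L CS (Q \<union> T)" "\<forall>Q\<in>I'. provable L CS (Q \<union> T)"
    have I: "I = {{Rhs (Forces w A)}, {Lhs (Forces w B)}}"
      "I' = {{Lhs (Forces w A), Rhs (Forces w B)}}"
      using schema_reducts[OF *(1,2)] schema_reducts[OF *(3,4)] by simp_all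
    have prem: "provable L CS (insert (Lhs (Forces w A)) (insert (Rhs (Forces w B)) T))"
      "provable L CS (insert (Rhs (Forces w A)) T)" "provable L CS (insert (Lhs (Forces w B)) T)"
      using *(5,6) I by simp_all
    have weak: "provable L CS (insert (Rhs (Forces w A)) (insert (Rhs (Forces w B)) T))"
      using prem(2) by (rule provable_weaken) blast
    have cutA: "provable L CS (insert (Rhs (Forces w B)) T)"
      by (rule Imp.IH(1)[OF prem(1) weak])
    show "provable L CS T"
      by (rule Imp.IH(2)[OF prem(3) cutA])
  qed
next
  case (Just t A)
  show ?case
  proof (rule principal_cut[OF Just.prems])
    fix P D I P' D' I' T
    assume *: "schema L CS P D I" "Lhs (Forces w (Just t A)) \<in> P \<union> D"
      "P \<union> D \<subseteq> insert (Lhs (Forces w (Just t A))) T"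
      "schema L CS P' D' I'" "Rhs (Forces w (Just t A)) \<in> P' \<union> D'"
      "P' \<union> D' \<subseteq> insert (Rhs (Forces w (Just t A))) T"
      "\<forall>Q\<in>I. provable L CS (Q \<union> T)" "\<forall>Q\<in>I'. provable L CS (Q \<union> T)"
    have I': "P' = {Lhs (Ev w t A)}" "I' = range (\<lambda>v. {Lhs (Rel w v), Rhs (Forces v A)})"
      using *(4) by (cases; use *(5) in auto)+
    \<comment> \<open>The left copy is used by (L:) or by (E).\<close>
    consider v where "Lhs (Rel w v) \<in> T" "I = {{Lhs (Forces v A)}}" | "I = {{Lhs (Ev w t A)}}"
      using *(1) by cases (use *(2,3) in auto)
    then show "provable L CS T"
    proof cases
      case 1
      have "provable L CS ({Lhs (Rel w v), Rhs (Forces v A)} \<union> T)"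
        using *(8) I'(2) by blast
      then have "provable L CS (insert (Rhs (Forces v A)) T)"
        by (rule provable_weaken) (use 1(1) in blast)
      moreover have "provable L CS (insert (Lhs (Forces v A)) T)"
        using *(7) 1(2) by auto
      ultimately show ?thesis
        by (rule Just.IH[rotated])
    next
      case 2
      then show ?thesis
        using *(6,7) I'(1) by (auto simp: insert_absorb)
    qed
  qed
qed

lemma provable_cut:
  assumes "provable L CS (insert (Lhs \<phi>) S)" "provable L CS (insert (Rhs \<phi>) S)"
  shows "provable L CS S"
proof (cases \<phi>)
  case (Forces w A)
  then show ?thesis
    using cut_forces assms by blast
next
  case (Rel w v)
  show ?thesis
    by (rule cut_atom[OF assms]) (simp only: Rel, erule schema.cases; auto)
next
  case (Ev w t A)
  show ?thesis
    by (rule cut_atom[OF assms]) (simp only: Ev, erule schema.cases; auto)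
qed

section \<open>From the labelled calculus to the cumulative calculus\<close>

primrec relabel :: "(label \<Rightarrow> label) \<Rightarrow> ('p, 'x, 'c) lfm \<Rightarrow> ('p, 'x, 'c) lfm" where
  "relabel \<sigma> (Forces w A) = Forces (\<sigma> w) A"
| "relabel \<sigma> (Rel w v) = Rel (\<sigma> w) (\<sigma> v)"
| "relabel \<sigma> (Ev w t A) = Ev (\<sigma> w) t A"

lemma relabel_id: "relabel (\<lambda>w. w) \<phi> = \<phi>"
  by (cases \<phi>) auto

lemma lfm_lang_relabel: "lfm_lang L (relabel \<sigma> \<phi>) = lfm_lang L \<phi>"
  by (cases \<phi>) auto

lemma relabel_fresh: "v \<notin> lfm_labels \<phi> \<Longrightarrow> relabel (\<sigma>(v := u)) \<phi> = relabel \<sigma> \<phi>"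
  by (cases \<phi>) auto

primrec signed :: "(label \<Rightarrow> label) \<Rightarrow> ('p, 'x, 'c) sequent \<Rightarrow> ('p, 'x, 'c) sfm set" where
  "signed \<sigma> (\<Gamma> \<Rrightarrow> \<Delta>) = (\<lambda>\<phi>. Lhs (relabel \<sigma> \<phi>)) ` set_mset \<Gamma> \<union> (\<lambda>\<phi>. Rhs (relabel \<sigma> \<phi>)) ` set_mset \<Delta>"

lemma signed_fresh: "v \<notin> seq_labels S \<Longrightarrow> signed (\<sigma>(v := u)) S = signed \<sigma> S"
  by (cases S) (auto simp: relabel_fresh image_Un intro!: arg_cong2[of _ _ _ _ "(\<union>)"] image_cong)

lemma derivable_lang: "derivable L CS S \<Longrightarrow> seq_lang L S"
  by (erule derivable.cases) simp

lemma sfm_lang_signed: "seq_lang L S \<Longrightarrow> \<chi> \<in> signed \<sigma> S \<Longrightarrow> sfm_lang L \<chi>"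
  by (cases S) (auto simp: lfm_lang_relabel)

text \<open>
  The statement for all relabellings is what makes the induction work: an eigenlabel \<open>v\<close> does not
  occur in the conclusion, so sending it to an arbitrary \<open>u\<close> leaves the translated conclusion
  unchanged, and the single original premise becomes the premise for \<open>u\<close>.
\<close>
lemma derivable_provable:
  assumes "derivable L CS S"
  shows "provable L CS (signed \<sigma> S)"
  using assms
proof (induction arbitrary: \<sigma> rule: derivable.induct)
  case (1 Ps S)
  have step: "provable L CS (signed \<sigma> S)"
    if "schema L CS P D I" "P \<union> D \<subseteq> signed \<sigma> S"
      and Q: "\<And>Q. Q \<in> I \<Longrightarrow> \<exists>\<tau>. \<exists>S'\<in>set Ps. Q \<subseteq> signed \<tau> S' \<and> signed \<tau> S' \<subseteq> Q \<union> signed \<sigma> S"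
    for P D I
  proof (rule provable.step[OF that(1,2)])
    show "\<forall>\<chi>\<in>\<Union>I. sfm_lang L \<chi>"
    proof
      fix \<chi> assume "\<chi> \<in> \<Union>I"
      with Q obtain \<tau> S' where "S' \<in> set Ps" "\<chi> \<in> signed \<tau> S'"
        by blast
      with 1(3) show "sfm_lang L \<chi>"
        by (blast intro: sfm_lang_signed derivable_lang)
    qed
  next
    fix Q assume "Q \<in> I"
    with Q obtain \<tau> S' where "S' \<in> set Ps" "signed \<tau> S' \<subseteq> Q \<union> signed \<sigma> S"
      by blast
    with 1(3) show "provable L CS (Q \<union> signed \<sigma> S)"
      by (blast intro: provable_weaken)
  qed
  have step': "provable L CS (signed \<sigma> S)"
    if "schema L CS P D I" "P \<union> D \<subseteq> signed \<sigma> S"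
      and "\<And>Q. Q \<in> I \<Longrightarrow> \<exists>S'\<in>set Ps. Q \<subseteq> signed \<sigma> S' \<and> signed \<sigma> S' \<subseteq> Q \<union> signed \<sigma> S"
    for P D I
    using that by (intro step) blast+
  show ?case
    using 1(1)
  proof cases
    case (InitP w P \<Gamma> \<Delta>)
    show ?thesis
      by (rule step'[OF schema.InitP[of L CS "\<sigma> w" P]]) (auto simp: InitP)
  next
    case (InitBot w \<Gamma> \<Delta>)
    show ?thesis
      by (rule step'[OF schema.InitBot[of L CS "\<sigma> w"]]) (auto simp: InitBot)
  next
    case (InitR w v \<Gamma> \<Delta>)
    show ?thesis
      by (rule step'[OF schema.InitR[of L CS "\<sigma> w" "\<sigma> v"]]) (auto simp: InitR)
  next
    case (InitE w t A \<Gamma> \<Delta>)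
    show ?thesis
      by (rule step'[OF schema.InitE[of L CS "\<sigma> w" t A]]) (auto simp: InitE)
  next
    case (LNeg \<Gamma> w A \<Delta>)
    show ?thesis
      by (rule step'[OF schema.LNeg[of L CS "\<sigma> w" A]]) (auto simp: LNeg)
  next
    case (RNeg w A \<Gamma> \<Delta>)
    show ?thesis
      by (rule step'[OF schema.RNeg[of L CS "\<sigma> w" A]]) (auto simp: RNeg)
  next
    case (LConj w A B \<Gamma> \<Delta>)
    show ?thesis
      by (rule step'[OF schema.LConj[of L CS "\<sigma> w" A B]]) (auto simp: LConj)
  next
    case (RConj \<Gamma> w A \<Delta> B)
    show ?thesis
      by (rule step'[OF schema.RConj[of L CS "\<sigma> w" A B]]) (auto simp: RConj)
  next
    case (LDisj w A \<Gamma> \<Delta> B)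
    show ?thesis
      by (rule step'[OF schema.LDisj[of L CS "\<sigma> w" A B]]) (auto simp: LDisj)
  next
    case (RDisj \<Gamma> w A B \<Delta>)
    show ?thesis
      by (rule step'[OF schema.RDisj[of L CS "\<sigma> w" A B]]) (auto simp: RDisj)
  next
    case (LImp \<Gamma> w A \<Delta> B)
    show ?thesis
      by (rule step'[OF schema.LImp[of L CS "\<sigma> w" A B]]) (auto simp: LImp)
  next
    case (RImp w A \<Gamma> B \<Delta>)
    show ?thesis
      by (rule step'[OF schema.RImp[of L CS "\<sigma> w" A B]]) (auto simp: RImp)
  next
    case (LJust v A w t \<Gamma> \<Delta>)
    show ?thesis
      by (rule step'[OF schema.LJust[of L CS "\<sigma> w" t A "\<sigma> v"]]) (auto simp: LJust)
  next
    case (RJust v w t A \<Gamma> \<Delta>)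
    have fresh: "signed (\<sigma>(v := u)) S = signed \<sigma> S" for u
      using RJust by (intro signed_fresh) simp
    have "v \<noteq> w"
      using RJust(3) by auto
    then have prem: "{Lhs (Rel (\<sigma> w) u), Rhs (Forces u A)} \<subseteq> signed (\<sigma>(v := u)) (hd Ps) \<and>
        signed (\<sigma>(v := u)) (hd Ps) \<subseteq>
          {Lhs (Rel (\<sigma> w) u), Rhs (Forces u A)} \<union> signed \<sigma> S" for u
      using RJust(1,2) unfolding fresh[of u, symmetric] by auto
    show ?thesis
    proof (rule step[OF schema.RJust[of L CS "\<sigma> w" t A]])
      show "{Lhs (Ev (\<sigma> w) t A)} \<union> {Rhs (Forces (\<sigma> w) (Just t A))} \<subseteq> signed \<sigma> S"
        by (simp add: RJust)
    next
      fix Q assume "Q \<in> range (\<lambda>v. {Lhs (Rel (\<sigma> w) v), Rhs (Forces v A)})"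
      then obtain u where Q: "Q = {Lhs (Rel (\<sigma> w) u), Rhs (Forces u A)}"
        by blast
      have "hd Ps \<in> set Ps"
        by (simp add: RJust)
      with prem[of u] show "\<exists>\<tau>. \<exists>S'\<in>set Ps. Q \<subseteq> signed \<tau> S' \<and> signed \<tau> S' \<subseteq> Q \<union> signed \<sigma> S"
        unfolding Q by blast
    qed
  next
    case (E w t A \<Gamma> \<Delta>)
    show ?thesis
      by (rule step'[OF schema.E[of L CS "\<sigma> w" t A]]) (auto simp: E)
  next
    case (EPlusL w s t A \<Gamma> \<Delta>)
    show ?thesis
      by (rule step'[OF schema.EPlusL[of L CS "\<sigma> w" t A s]]) (auto simp: EPlusL)
  next
    case (EPlusR w t s A \<Gamma> \<Delta>)
    show ?thesis
      by (rule step'[OF schema.EPlusR[of L CS "\<sigma> w" t A s]]) (auto simp: EPlusR)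
  next
    case (EApp w s t B A \<Gamma> \<Delta>)
    show ?thesis
      by (rule step'[OF schema.EApp[of L CS "\<sigma> w" s A B t]]) (auto simp: EApp)
  next
    case (AN c F w \<Gamma> \<Delta>)
    show ?thesis
      by (rule step'[OF schema.AN[OF AN(3), of L "\<sigma> w"]]) (auto simp: AN)
  next
    case (Ref w \<Gamma> \<Delta>)
    show ?thesis
      by (rule step'[OF schema.Ref[OF Ref(3), of CS "\<sigma> w"]]) (auto simp: Ref)
  next
    case (Ser v \<Gamma> \<Delta> w)
    have fresh: "signed (\<sigma>(v := u)) S = signed \<sigma> S" for u
      using Ser by (intro signed_fresh) simp
    have mem: "hd Ps \<in> set Ps"
      by (simp add: Ser)
    have prem: "{Lhs (Rel ((\<sigma>(v := u)) w) u)} \<subseteq> signed (\<sigma>(v := u)) (hd Ps) \<and>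
        signed (\<sigma>(v := u)) (hd Ps) \<subseteq> {Lhs (Rel ((\<sigma>(v := u)) w) u)} \<union> signed \<sigma> S" for u
      using Ser(1,2) unfolding fresh[of u, symmetric] by auto
    show ?thesis
    \<comment> \<open>If \<open>w = v\<close>, then \<open>w\<close> moves along with the eigenlabel and the premise is a loop at \<open>u\<close>.\<close>
    proof (cases "w = v")
      case True
      show ?thesis
        by (rule step[OF schema.SerLoop[OF Ser(3) finite.emptyI]])
          (use prem mem True in fastforce)+
    next
      case False
      show ?thesis
        by (rule step[OF schema.Ser[OF Ser(3), of CS "\<sigma> w"]])
          (use prem mem False in fastforce)+
    qed
  next
    case (EBang w t A \<Gamma> \<Delta>)
    show ?thesis
      by (rule step'[OF schema.EBang[OF EBang(3), of CS "\<sigma> w" t A]]) (auto simp: EBang)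
  next
    case (Mon v t A w \<Gamma> \<Delta>)
    show ?thesis
      by (rule step'[OF schema.Mon[OF Mon(3), of CS "\<sigma> w" t A "\<sigma> v"]]) (auto simp: Mon)
  next
    case (Trans w u v \<Gamma> \<Delta>)
    show ?thesis
      by (rule step'[OF schema.Trans[OF Trans(3), of CS "\<sigma> w" "\<sigma> v" "\<sigma> u"]]) (auto simp: Trans)
  next
    case (EQuestBar w A \<Gamma> \<Delta> t)
    show ?thesis
      by (rule step'[OF schema.EQuestBar[OF EQuestBar(3), of CS "\<sigma> w" A t]]) (auto simp: EQuestBar)
  next
    case (Sym v w \<Gamma> \<Delta>)
    show ?thesis
      by (rule step'[OF schema.Sym[OF Sym(3), of CS "\<sigma> w" "\<sigma> v"]]) (auto simp: Sym)
  next
    case (SE w t A \<Gamma> \<Delta>)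
    show ?thesis
      by (rule step'[OF schema.SE[OF SE(3), of CS "\<sigma> w" t A]]) (auto simp: SE)
  next
    case (EQuest w t A \<Gamma> \<Delta>)
    show ?thesis
      by (rule step'[OF schema.EQuest[OF EQuest(3), of CS "\<sigma> w" t A]]) (auto simp: EQuest)
  qed
qed

section \<open>From the cumulative calculus back to the labelled calculus\<close>

text \<open>
  Closing \<open>G\<close> under passing from all formulas of a reduct to the formula they come from. A sequent
  that has been decomposed by its rules still covers the original formulas.
\<close>
inductive_set covered :: "('p, 'x, 'c) sfm set \<Rightarrow> ('p, 'x, 'c) sfm set" for G where
  present: "\<chi> \<in> G \<Longrightarrow> \<chi> \<in> covered G"
| reduct: "Q \<in> reducts \<chi> \<Longrightarrow> \<forall>\<psi>\<in>Q. \<psi> \<in> covered G \<Longrightarrow> \<chi> \<in> covered G"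

lemma covered_trans:
  assumes "\<chi> \<in> covered G" "G \<subseteq> covered H"
  shows "\<chi> \<in> covered H"
  using assms
  by (induction rule: covered.induct) (blast intro: covered.reduct)+

lemma finite_seq_labels: "finite (seq_labels S)"
proof -
  have "finite (lfm_labels \<phi>)" for \<phi> :: "('p, 'x, 'c) lfm"
    by (cases \<phi>) auto
  then show ?thesis
    by (cases S) auto
qed

lemma mset_split2:
  assumes "x \<in># M" "y \<in># M" "x \<noteq> y"
  obtains N where "M = add_mset x (add_mset y N)"
  using assms by (metis insert_DiffM insert_noteq_member)

lemma signed_id: "signed (\<lambda>w. w) (\<Gamma> \<Rrightarrow> \<Delta>) = Lhs ` set_mset \<Gamma> \<union> Rhs ` set_mset \<Delta>"
  by (simp add: relabel_id)

text \<open>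
  One step of the translation, for a sequent that contains the principal formulas. A consumed
  formula may have disappeared from the premise, hence \<open>- D\<close>; it is not known to have disappeared,
  as the multiset may contain several copies.
\<close>
lemma derivable_schema:
  fixes S :: "('p, 'x, 'c) sequent"
  assumes "schema L CS P D I" "P \<union> D \<subseteq> signed (\<lambda>w. w) S" "seq_lang L S"
    and lang: "\<forall>\<chi>\<in>\<Union>I. sfm_lang L \<chi>"
    and prem: "\<And>Q S'. Q \<in> I \<Longrightarrow> seq_lang L S' \<Longrightarrow>
      Q \<union> (signed (\<lambda>w. w) S - D) \<subseteq> signed (\<lambda>w. w) S' \<Longrightarrow> derivable L CS S'"
  shows "derivable L CS S"
proof -
  obtain \<Gamma> \<Delta> where S: "S = (\<Gamma> \<Rrightarrow> \<Delta>)"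
    by (cases S)
  have sub: "P \<union> D \<subseteq> Lhs ` set_mset \<Gamma> \<union> Rhs ` set_mset \<Delta>"
    using assms(2) unfolding S signed_id .
  have rule: "derivable L CS S" if "G3JL_rule L CS Ps S" "\<And>S'. S' \<in> set Ps \<Longrightarrow> derivable L CS S'" for Ps
    using derivable.intros[OF that(1) assms(3)] that(2) by blast
  have premise: "derivable L CS (\<Gamma>' \<Rrightarrow> \<Delta>')"
    if "Q \<in> I"
      and "Q \<union> (Lhs ` set_mset \<Gamma> \<union> Rhs ` set_mset \<Delta> - D) \<subseteq> Lhs ` set_mset \<Gamma>' \<union> Rhs ` set_mset \<Delta>'"
      and sup: "Lhs ` set_mset \<Gamma>' \<union> Rhs ` set_mset \<Delta>' \<subseteq> Q \<union> (Lhs ` set_mset \<Gamma> \<union> Rhs ` set_mset \<Delta>)"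
    for Q \<Gamma>' \<Delta>'
  proof (rule prem[OF that(1)])
    have "sfm_lang L \<chi>" if "\<chi> \<in> Q \<union> (Lhs ` set_mset \<Gamma> \<union> Rhs ` set_mset \<Delta>)" for \<chi>
      using that \<open>Q \<in> I\<close> lang assms(3) by (auto simp: S)
    with sup have "\<forall>\<chi> \<in> Lhs ` set_mset \<Gamma>' \<union> Rhs ` set_mset \<Delta>'. sfm_lang L \<chi>"
      by blast
    then show "seq_lang L (\<Gamma>' \<Rrightarrow> \<Delta>')"
      by (auto simp: ball_Un)
    show "Q \<union> (signed (\<lambda>w. w) S - D) \<subseteq> signed (\<lambda>w. w) (\<Gamma>' \<Rrightarrow> \<Delta>')"
      using that(2) unfolding S signed_id .
  qed
  show ?thesis
    using assms(1)
  proof cases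
    case (InitP w P)
    obtain \<Gamma>0 where G: "\<Gamma> = add_mset (Forces w (PVar P)) \<Gamma>0"
      using sub InitP(1,2) by (auto dest: multi_member_split)
    obtain \<Delta>0 where D: "\<Delta> = add_mset (Forces w (PVar P)) \<Delta>0"
      using sub InitP(1,2) by (auto dest: multi_member_split)
    show ?thesis
      by (rule rule, unfold S G D, rule G3JL_rule.InitP) simp
  next
    case (InitBot w)
    obtain \<Gamma>0 where G: "\<Gamma> = add_mset (Forces w Bot) \<Gamma>0"
      using sub InitBot(1,2) by (auto dest: multi_member_split)
    show ?thesis
      by (rule rule, unfold S G, rule G3JL_rule.InitBot) simp
  next
    case (InitR w v)
    obtain \<Gamma>0 where G: "\<Gamma> = add_mset (Rel w v) \<Gamma>0"
      using sub InitR(1,2) by (auto dest: multi_member_split)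
    obtain \<Delta>0 where D: "\<Delta> = add_mset (Rel w v) \<Delta>0"
      using sub InitR(1,2) by (auto dest: multi_member_split)
    show ?thesis
      by (rule rule, unfold S G D, rule G3JL_rule.InitR) simp
  next
    case (InitE w t A)
    obtain \<Gamma>0 where G: "\<Gamma> = add_mset (Ev w t A) \<Gamma>0"
      using sub InitE(1,2) by (auto dest: multi_member_split)
    obtain \<Delta>0 where D: "\<Delta> = add_mset (Ev w t A) \<Delta>0"
      using sub InitE(1,2) by (auto dest: multi_member_split)
    show ?thesis
      by (rule rule, unfold S G D, rule G3JL_rule.InitE) simp
  next
    case (LNeg w A)
    obtain \<Gamma>0 where G: "\<Gamma> = add_mset (Forces w (Neg A)) \<Gamma>0"
      using sub LNeg(1,2) by (auto dest: multi_member_split)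
    show ?thesis
      by (rule rule, unfold S G, rule G3JL_rule.LNeg)
        (use LNeg(2,3) G in \<open>auto intro!: premise[of "{Rhs (Forces w A)}"]\<close>)
  next
    case (RNeg w A)
    obtain \<Delta>0 where D: "\<Delta> = add_mset (Forces w (Neg A)) \<Delta>0"
      using sub RNeg(1,2) by (auto dest: multi_member_split)
    show ?thesis
      by (rule rule, unfold S D, rule G3JL_rule.RNeg)
        (use RNeg(2,3) D in \<open>auto intro!: premise[of "{Lhs (Forces w A)}"]\<close>)
  next
    case (LConj w A B)
    obtain \<Gamma>0 where G: "\<Gamma> = add_mset (Forces w (Conj A B)) \<Gamma>0"
      using sub LConj(1,2) by (auto dest: multi_member_split)
    show ?thesis
      by (rule rule, unfold S G, rule G3JL_rule.LConj)
        (use LConj(2,3) G in \<open>auto intro!: premise[of "{Lhs (Forces w A), Lhs (Forces w B)}"]\<close>)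
  next
    case (RConj w A B)
    obtain \<Delta>0 where D: "\<Delta> = add_mset (Forces w (Conj A B)) \<Delta>0"
      using sub RConj(1,2) by (auto dest: multi_member_split)
    have left: "derivable L CS (\<Gamma> \<Rrightarrow> add_mset (Forces w A) \<Delta>0)"
      by (rule premise[of "{Rhs (Forces w A)}"]) (use RConj(2,3) D in auto)
    have right: "derivable L CS (\<Gamma> \<Rrightarrow> add_mset (Forces w B) \<Delta>0)"
      by (rule premise[of "{Rhs (Forces w B)}"]) (use RConj(2,3) D in auto)
    show ?thesis
      by (rule rule, unfold S D, rule G3JL_rule.RConj) (use left right in auto)
  next
    case (LDisj w A B)
    obtain \<Gamma>0 where G: "\<Gamma> = add_mset (Forces w (Disj A B)) \<Gamma>0"
      using sub LDisj(1,2) by (auto dest: multi_member_split)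
    have left: "derivable L CS (add_mset (Forces w A) \<Gamma>0 \<Rrightarrow> \<Delta>)"
      by (rule premise[of "{Lhs (Forces w A)}"]) (use LDisj(2,3) G in auto)
    have right: "derivable L CS (add_mset (Forces w B) \<Gamma>0 \<Rrightarrow> \<Delta>)"
      by (rule premise[of "{Lhs (Forces w B)}"]) (use LDisj(2,3) G in auto)
    show ?thesis
      by (rule rule, unfold S G, rule G3JL_rule.LDisj) (use left right in auto)
  next
    case (RDisj w A B)
    obtain \<Delta>0 where D: "\<Delta> = add_mset (Forces w (Disj A B)) \<Delta>0"
      using sub RDisj(1,2) by (auto dest: multi_member_split)
    show ?thesis
      by (rule rule, unfold S D, rule G3JL_rule.RDisj)
        (use RDisj(2,3) D in \<open>auto intro!: premise[of "{Rhs (Forces w A), Rhs (Forces w B)}"]\<close>)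
  next
    case (LImp w A B)
    obtain \<Gamma>0 where G: "\<Gamma> = add_mset (Forces w (Imp A B)) \<Gamma>0"
      using sub LImp(1,2) by (auto dest: multi_member_split)
    have left: "derivable L CS (\<Gamma>0 \<Rrightarrow> add_mset (Forces w A) \<Delta>)"
      by (rule premise[of "{Rhs (Forces w A)}"]) (use LImp(2,3) G in auto)
    have right: "derivable L CS (add_mset (Forces w B) \<Gamma>0 \<Rrightarrow> \<Delta>)"
      by (rule premise[of "{Lhs (Forces w B)}"]) (use LImp(2,3) G in auto)
    show ?thesis
      by (rule rule, unfold S G, rule G3JL_rule.LImp) (use left right in auto)
  next
    case (RImp w A B)
    obtain \<Delta>0 where D: "\<Delta> = add_mset (Forces w (Imp A B)) \<Delta>0"
      using sub RImp(1,2) by (auto dest: multi_member_split)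
    show ?thesis
      by (rule rule, unfold S D, rule G3JL_rule.RImp)
        (use RImp(2,3) D in \<open>auto intro!: premise[of "{Lhs (Forces w A), Rhs (Forces w B)}"]\<close>)
  next
    case (LJust w t A v)
    obtain \<Gamma>0 where G: "\<Gamma> = add_mset (Forces w (Just t A)) (add_mset (Rel w v) \<Gamma>0)"
      using sub LJust(1,2) by (auto elim: mset_split2)
    show ?thesis
      by (rule rule, unfold S G, rule G3JL_rule.LJust)
        (use LJust(2,3) G in \<open>auto intro!: premise[of "{Lhs (Forces v A)}"]\<close>)
  next
    case (RJust w t A)
    obtain \<Gamma>0 where G: "\<Gamma> = add_mset (Ev w t A) \<Gamma>0"
      using sub RJust(1,2) by (auto dest: multi_member_split)
    obtain \<Delta>0 where D: "\<Delta> = add_mset (Forces w (Just t A)) \<Delta>0"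
      using sub RJust(1,2) by (auto dest: multi_member_split)
    obtain v where v: "v \<notin> seq_labels S"
      using ex_new_if_finite[OF infinite_UNIV_nat finite_seq_labels] by blast
    show ?thesis
      by (rule rule, unfold S G D, rule G3JL_rule.RJust[OF v[unfolded S G D]])
        (use RJust(2,3) G D in \<open>auto intro!: premise[of "{Lhs (Rel w v), Rhs (Forces v A)}"]\<close>)
  next
    case (E w t A)
    obtain \<Gamma>0 where G: "\<Gamma> = add_mset (Forces w (Just t A)) \<Gamma>0"
      using sub E(1,2) by (auto dest: multi_member_split)
    show ?thesis
      by (rule rule, unfold S G, rule G3JL_rule.E)
        (use E(2,3) G in \<open>auto intro!: premise[of "{Lhs (Ev w t A)}"]\<close>)
  next
    case (EPlusL w t A s)
    obtain \<Gamma>0 where G: "\<Gamma> = add_mset (Ev w t A) \<Gamma>0"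
      using sub EPlusL(1,2) by (auto dest: multi_member_split)
    show ?thesis
      by (rule rule, unfold S G, rule G3JL_rule.EPlusL[where s = s])
        (use EPlusL(2,3) G in \<open>auto intro!: premise[of "{Lhs (Ev w (Plus s t) A)}"]\<close>)
  next
    case (EPlusR w t A s)
    obtain \<Gamma>0 where G: "\<Gamma> = add_mset (Ev w t A) \<Gamma>0"
      using sub EPlusR(1,2) by (auto dest: multi_member_split)
    show ?thesis
      by (rule rule, unfold S G, rule G3JL_rule.EPlusR[where s = s])
        (use EPlusR(2,3) G in \<open>auto intro!: premise[of "{Lhs (Ev w (Plus t s) A)}"]\<close>)
  next
    case (EApp w s A B t)
    obtain \<Gamma>0 where G: "\<Gamma> = add_mset (Ev w s (Imp A B)) (add_mset (Ev w t A) \<Gamma>0)"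
      using sub EApp(1,2) by (auto elim: mset_split2)
    show ?thesis
      by (rule rule, unfold S G, rule G3JL_rule.EApp)
        (use EApp(2,3) G in \<open>auto intro!: premise[of "{Lhs (Ev w (App s t) B)}"]\<close>)
  next
    case (AN c F w)
    show ?thesis
      by (rule rule, unfold S, rule G3JL_rule.AN[where w = w, OF AN(4)])
        (use AN(2,3) in \<open>auto intro!: premise[of "{Lhs (Ev w (JConst c) F)}"]\<close>)
  next
    case (Ref w)
    show ?thesis
      by (rule rule, unfold S, rule G3JL_rule.Ref[where w = w, OF Ref(4)])
        (use Ref(2,3) in \<open>auto intro!: premise[of "{Lhs (Rel w w)}"]\<close>)
  next
    case (Ser w)
    obtain v where v: "v \<notin> seq_labels S"
      using ex_new_if_finite[OF infinite_UNIV_nat finite_seq_labels] by blast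
    show ?thesis
      by (rule rule, unfold S, rule G3JL_rule.Ser[where w = w, OF Ser(4) v[unfolded S]])
        (use Ser(2,3) in \<open>auto intro!: premise[of "{Lhs (Rel w v)}"]\<close>)
  next
    case (SerLoop F)
    \<comment> \<open>(Ser) with \<open>w = v\<close>, at a label that is new to the sequent and one of those with a premise\<close>
    obtain v where v: "v \<notin> seq_labels S" "v \<notin> F"
      using ex_new_if_finite[OF infinite_UNIV_nat, of "seq_labels S \<union> F"] finite_seq_labels SerLoop(5)
      by auto
    show ?thesis
      by (rule rule, unfold S, rule G3JL_rule.Ser[where w = v, OF SerLoop(4) v(1)[unfolded S]])
        (use SerLoop(2,3) v(2) in \<open>auto intro!: premise[of "{Lhs (Rel v v)}"]\<close>)
  next
    case (EBang w t A)
    obtain \<Gamma>0 where G: "\<Gamma> = add_mset (Ev w t A) \<Gamma>0"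
      using sub EBang(1,2) by (auto dest: multi_member_split)
    show ?thesis
      by (rule rule, unfold S G, rule G3JL_rule.EBang[OF EBang(4)])
        (use EBang(2,3) G in \<open>auto intro!: premise[of "{Lhs (Ev w (Bang t) (Just t A))}"]\<close>)
  next
    case (Mon w t A v)
    obtain \<Gamma>0 where G: "\<Gamma> = add_mset (Ev w t A) (add_mset (Rel w v) \<Gamma>0)"
      using sub Mon(1,2) by (auto elim: mset_split2)
    show ?thesis
      by (rule rule, unfold S G, rule G3JL_rule.Mon[OF Mon(4)])
        (use Mon(2,3) G in \<open>auto intro!: premise[of "{Lhs (Ev v t A)}"]\<close>)
  next
    case (Trans w v u)
    show ?thesis
    \<comment> \<open>(Trans) needs two occurrences of a loop that may occur only once, but then it adds nothing new.\<close>
    proof (cases "w = v \<and> v = u")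
      case True
      then show ?thesis
        using sub Trans(1-3) by (auto simp: S intro!: premise[of "{Lhs (Rel w u)}"])
    next
      case False
      obtain \<Gamma>0 where G: "\<Gamma> = add_mset (Rel w v) (add_mset (Rel v u) \<Gamma>0)"
        using sub Trans(1,2) False by (auto elim: mset_split2)
      show ?thesis
        by (rule rule, unfold S G, rule G3JL_rule.Trans[OF Trans(4)])
          (use Trans(2,3) G in \<open>auto intro!: premise[of "{Lhs (Rel w u)}"]\<close>)
    qed
  next
    case (EQuestBar w A t)
    have left: "derivable L CS (add_mset (Forces w A) \<Gamma> \<Rrightarrow> \<Delta>)"
      by (rule premise[of "{Lhs (Forces w A)}"]) (use EQuestBar(2,3) in auto)
    have right: "derivable L CS (add_mset (Ev w (QuestBar t) (Neg (Just t A))) \<Gamma> \<Rrightarrow> \<Delta>)"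
      by (rule premise[of "{Lhs (Ev w (QuestBar t) (Neg (Just t A)))}"]) (use EQuestBar(2,3) in auto)
    show ?thesis
      by (rule rule, unfold S, rule G3JL_rule.EQuestBar[where w = w and t = t and A = A, OF EQuestBar(4)])
        (use left right in auto)
  next
    case (Sym w v)
    obtain \<Gamma>0 where G: "\<Gamma> = add_mset (Rel w v) \<Gamma>0"
      using sub Sym(1,2) by (auto dest: multi_member_split)
    show ?thesis
      by (rule rule, unfold S G, rule G3JL_rule.Sym[OF Sym(4)])
        (use Sym(2,3) G in \<open>auto intro!: premise[of "{Lhs (Rel v w)}"]\<close>)
  next
    case (SE w t A)
    obtain \<Gamma>0 where G: "\<Gamma> = add_mset (Ev w t A) \<Gamma>0"
      using sub SE(1,2) by (auto dest: multi_member_split)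
    show ?thesis
      by (rule rule, unfold S G, rule G3JL_rule.SE[OF SE(4)])
        (use SE(2,3) G in \<open>auto intro!: premise[of "{Lhs (Forces w (Just t A))}"]\<close>)
  next
    case (EQuest w t A)
    have left: "derivable L CS (add_mset (Ev w t A) \<Gamma> \<Rrightarrow> \<Delta>)"
      by (rule premise[of "{Lhs (Ev w t A)}"]) (use EQuest(2,3) in auto)
    have right: "derivable L CS (add_mset (Ev w (Quest t) (Neg (Just t A))) \<Gamma> \<Rrightarrow> \<Delta>)"
      by (rule premise[of "{Lhs (Ev w (Quest t) (Neg (Just t A)))}"]) (use EQuest(2,3) in auto)
    show ?thesis
      by (rule rule, unfold S, rule G3JL_rule.EQuest[where w = w and t = t and A = A, OF EQuest(4)])
        (use left right in auto)
  qed
qed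

text \<open>
  Formulas that rules repeat have no reducts, so they are covered only if they occur in \<open>S\<close>. A
  consumed formula of the last rule either occurs, and the original rule applies; afterwards the
  formula is covered by what the premise has added. Or it is covered through one of its reducts,
  that is, one premise of the last rule is covered already, and the induction hypothesis for that
  premise concludes.
\<close>
lemma provable_derivable:
  assumes "provable L CS N" "N \<subseteq> covered (signed (\<lambda>w. w) S)" "seq_lang L S"
  shows "derivable L CS S"
  using assms
proof (induction arbitrary: S rule: provable.induct)
  case (step P D I N)
  let ?G = "signed (\<lambda>w. w) S"
  have cov: "P \<union> D \<subseteq> covered ?G"
    using step.hyps(2) step.prems(1) by blast
  have P: "P \<subseteq> ?G"
  proof
    fix \<chi> assume "\<chi> \<in> P"
    with cov have "\<chi> \<in> covered ?G"
      by blast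
    then show "\<chi> \<in> ?G"
      by cases (use schema_kept[OF step.hyps(1) \<open>\<chi> \<in> P\<close>] in auto)
  qed
  show ?case
  proof (cases "D \<subseteq> ?G")
    case True
    show ?thesis
    proof (rule derivable_schema[OF step.hyps(1) _ step.prems(2) step.hyps(3)])
      show "P \<union> D \<subseteq> ?G"
        using P True by blast
    next
      fix Q S'
      assume Q: "Q \<in> I" "seq_lang L S'" "Q \<union> (?G - D) \<subseteq> signed (\<lambda>w. w) S'"
      have "\<chi> \<in> covered (signed (\<lambda>w. w) S')" if "\<chi> \<in> ?G" for \<chi>
      proof (cases "\<chi> \<in> D")
        case True
        then have "Q \<in> reducts \<chi>"
          using schema_consumed[OF step.hyps(1)] Q(1) by blast
        then show ?thesis
          by (rule covered.reduct) (use Q(3) in \<open>blast intro: covered.present\<close>)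
      next
        case False
        then show ?thesis
          using that Q(3) by (blast intro: covered.present)
      qed
      then have "N \<subseteq> covered (signed (\<lambda>w. w) S')"
        using step.prems(1) by (blast intro: covered_trans)
      then show "derivable L CS S'"
        using step.IH[OF Q(1) _ Q(2)] Q(3) by (blast intro: covered.present)
    qed
  next
    case False
    then obtain \<chi> where \<chi>: "\<chi> \<in> D" "\<chi> \<notin> ?G"
      by blast
    then have "\<chi> \<in> covered ?G"
      using cov by blast
    then obtain Q where Q: "Q \<in> reducts \<chi>" "Q \<subseteq> covered ?G"
      using \<chi>(2) by cases auto
    then have "Q \<in> I"
      using schema_consumed[OF step.hyps(1) \<chi>(1)] by blast
    then show ?thesis
      using step.IH Q(2) step.prems by blast
  qed
qed

theorem theorem7p3:
  fixes L :: "scheme set" and CS :: "('p, 'x, 'c) fm set"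
  assumes "justification_logic L"
    and "constant_specification L CS"
  shows "admissible L CS Cut"
  unfolding admissible_def
proof (intro allI impI)
  fix Ps and S :: "('p, 'x, 'c) sequent"
  assume "Cut Ps S" and prems: "\<forall>P\<in>set Ps. derivable L CS P"
  then obtain \<Gamma> \<Delta> \<Gamma>' \<Delta>' \<phi> where
    Ps: "Ps = [\<Gamma> \<Rrightarrow> add_mset \<phi> \<Delta>, add_mset \<phi> \<Gamma>' \<Rrightarrow> \<Delta>']" and S: "S = (\<Gamma> + \<Gamma>' \<Rrightarrow> \<Delta> + \<Delta>')"
    by (auto elim: Cut.cases)
  let ?G = "signed (\<lambda>w. w) S"
  have left: "derivable L CS (\<Gamma> \<Rrightarrow> add_mset \<phi> \<Delta>)" and right: "derivable L CS (add_mset \<phi> \<Gamma>' \<Rrightarrow> \<Delta>')"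
    using prems by (simp_all add: Ps)
  have "provable L CS (insert (Rhs \<phi>) ?G)"
    by (rule provable_weaken[OF derivable_provable[OF left, of "\<lambda>w. w"]]) (auto simp: S relabel_id)
  moreover have "provable L CS (insert (Lhs \<phi>) ?G)"
    by (rule provable_weaken[OF derivable_provable[OF right, of "\<lambda>w. w"]]) (auto simp: S relabel_id)
  ultimately have "provable L CS ?G"
    by (rule provable_cut[rotated])
  moreover have "?G \<subseteq> covered ?G"
    by (blast intro: covered.present)
  moreover have "seq_lang L S"
    using derivable_lang[OF left] derivable_lang[OF right] by (auto simp: S)
  ultimately show "derivable L CS S"
    by (rule provable_derivable)
qed

end
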